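(* Let $N\ge 2$ and let $A,\Omega\subset\mathbb{R}^N$ be bounded open sets with $\overline{A}\subset\Omega$ such that $A$ has Lipschitz boundary. Let $\sigma$ be the surface measure on $\partial A$ and let $n$ be the unit normal vector field on $\partial A$ oriented outwards from $A$ (defined $\sigma$-almost everywhere). For each $a>0$ let $\tilde s_a\in H_0^1(\Omega)^N$ be the unique element satisfying $$a\int_\Omega(\nabla \tilde s_a:\nabla\varphi)\,dx+\int_{\Omega}(\tilde s_a,\varphi)\,dx=\int_{\partial A}(n,\varphi)\,d\sigma\qquad\text{for all }\varphi\in H_0^1(\Omega)^N.$$ Then $$\lim_{a\to0^+}\int_{\Omega}(\tilde s_a,\varphi)\,dx=\int_{\partial A}(n,\varphi)\,d\sigma\qquad\text{for all }\varphi\in H_0^1(\Omega)^N,$$ and $a \tilde s_a\to 0$ strongly in $H_0^1(\Omega)^N$ as $a\to0^+$.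
   Context: "$A$ has Lipschitz boundary" means: for each $x\in\partial A$ there is a neighborhood $U\subset\mathbb{R}^N$ of $x$ such that, in some orthogonal coordinate system, $\partial A\cap U$ is the graph of a Lipschitz function (of $N-1$ variables), with $A\cap U$ being the part of $U$ lying on one side of this graph. $(\cdot,\cdot)$ is the standard inner product of $\mathbb{R}^N$ and $(P:Q)=\mathrm{Tr}(P^TQ)$ is the Hilbert-Schmidt inner product of matrices. $H_0^1(\Omega)^N$ is the space of $\mathbb{R}^N$-valued functions with components in $H_0^1(\Omega)$, with inner product $\langle\varphi,\psi\rangle_{H_0^1(\Omega)^N}=\int_\Omega(\nabla\varphi:\nabla\psi)\,dx=\sum_{i,j=1}^N\langle\partial_{x_i}\varphi_j,\partial_{x_i}\psi_j\rangle_{L^2(\Omega)}$. In integrals over $\partial A$, $\varphi$ denotes its trace on $\partial A$; the trace map $H_0^1(\Omega)^N\to L^2(\partial A)^N$ is bounded. Existence and uniqueness of $\tilde s_a$ follow from the Lax-Milgram theorem. *)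

theory Defs
  imports "HOL-Analysis.Analysis"
begin

section \<open>Test functions\<close>

definition pderiv_at :: "'n::finite \<Rightarrow> (real^'n \<Rightarrow> real) \<Rightarrow> real^'n \<Rightarrow> real" where
  "pderiv_at i f x = frechet_derivative f (at x) (axis i 1)"

primrec Ck :: "nat \<Rightarrow> (real^'n::finite \<Rightarrow> real) \<Rightarrow> bool" where
  "Ck 0 f \<longleftrightarrow> continuous_on UNIV f"
| "Ck (Suc k) f \<longleftrightarrow> (\<forall>x. f differentiable (at x)) \<and> (\<forall>i. Ck k (pderiv_at i f))"

(* C_c^infinity(Omega), extended by zero to the whole space *)
definition test_functions :: "(real^'n::finite) set \<Rightarrow> (real^'n \<Rightarrow> real) set" where
  "test_functions \<Omega> = {\<psi>. (\<forall>k. Ck k \<psi>) \<and> compact (closure {x. \<psi> x \<noteq> 0}) \<and>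
                          closure {x. \<psi> x \<noteq> 0} \<subseteq> \<Omega>}"

section \<open>Sobolev spaces\<close>

text \<open>
  Elements of the function spaces are represented by functions on the whole space; only the
  values almost everywhere on \<open>\<Omega>\<close> matter.
\<close>

definition L2 :: "'a measure \<Rightarrow> ('a \<Rightarrow> real) set" where
  "L2 M = {f \<in> borel_measurable M. integrable M (\<lambda>x. (f x)\<^sup>2)}"

definition is_weak_pderiv ::
    "(real^'n::finite) set \<Rightarrow> 'n \<Rightarrow> (real^'n \<Rightarrow> real) \<Rightarrow> (real^'n \<Rightarrow> real) \<Rightarrow> bool" where
  "is_weak_pderiv \<Omega> i u v \<longleftrightarrow> v \<in> L2 (lebesgue_on \<Omega>) \<and>
     (\<forall>\<psi>\<in>test_functions \<Omega>.
        (LINT x|lebesgue_on \<Omega>. u x * pderiv_at i \<psi> x) = - (LINT x|lebesgue_on \<Omega>. v x * \<psi> x))"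

definition H1 :: "(real^'n::finite) set \<Rightarrow> (real^'n \<Rightarrow> real) set" where
  "H1 \<Omega> = {u \<in> L2 (lebesgue_on \<Omega>). \<forall>i. \<exists>v. is_weak_pderiv \<Omega> i u v}"

(* For u in H^1(Omega) this is determined up to a null set; a representative is chosen. *)
definition weak_pderiv ::
    "(real^'n::finite) set \<Rightarrow> 'n \<Rightarrow> (real^'n \<Rightarrow> real) \<Rightarrow> real^'n \<Rightarrow> real" where
  "weak_pderiv \<Omega> i u = (SOME v. is_weak_pderiv \<Omega> i u v)"

(* Convergence in H^1(Omega) of a sequence of test functions, whose weak derivatives are the
   classical ones. *)
definition H1_approx ::
    "(real^'n::finite) set \<Rightarrow> (nat \<Rightarrow> real^'n \<Rightarrow> real) \<Rightarrow> (real^'n \<Rightarrow> real) \<Rightarrow> bool" where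
  "H1_approx \<Omega> \<psi> u \<longleftrightarrow> (\<forall>k. \<psi> k \<in> test_functions \<Omega>) \<and>
     (\<lambda>k. LINT x|lebesgue_on \<Omega>. (\<psi> k x - u x)\<^sup>2) \<longlonglongrightarrow> 0 \<and>
     (\<forall>i. (\<lambda>k. LINT x|lebesgue_on \<Omega>. (pderiv_at i (\<psi> k) x - weak_pderiv \<Omega> i u x)\<^sup>2)
            \<longlonglongrightarrow> 0)"

definition H10 :: "(real^'n::finite) set \<Rightarrow> (real^'n \<Rightarrow> real) set" where
  "H10 \<Omega> = {u \<in> H1 \<Omega>. \<exists>\<psi>. H1_approx \<Omega> \<psi> u}"

definition H10_vec :: "(real^'n::finite) set \<Rightarrow> (real^'n \<Rightarrow> real^'n) set" where
  "H10_vec \<Omega> = {\<phi>. \<forall>j. (\<lambda>x. \<phi> x $ j) \<in> H10 \<Omega>}"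

definition weak_grad ::
    "(real^'n::finite) set \<Rightarrow> (real^'n \<Rightarrow> real^'n) \<Rightarrow> real^'n \<Rightarrow> real^'n^'n" where
  "weak_grad \<Omega> \<phi> x = (\<chi> i j. weak_pderiv \<Omega> i (\<lambda>y. \<phi> y $ j) x)"

definition HS_inner :: "real^'n^'n \<Rightarrow> real^'n^'n \<Rightarrow> real" where
  "HS_inner P Q = trace (transpose P ** Q)"

definition H10_inner ::
    "(real^'n::finite) set \<Rightarrow> (real^'n \<Rightarrow> real^'n) \<Rightarrow> (real^'n \<Rightarrow> real^'n) \<Rightarrow> real" where
  "H10_inner \<Omega> \<phi> \<psi> = (LINT x|lebesgue_on \<Omega>. HS_inner (weak_grad \<Omega> \<phi> x) (weak_grad \<Omega> \<psi> x))"

definition H10_norm :: "(real^'n::finite) set \<Rightarrow> (real^'n \<Rightarrow> real^'n) \<Rightarrow> real" where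
  "H10_norm \<Omega> \<phi> = sqrt (H10_inner \<Omega> \<phi> \<phi>)"

section \<open>Lipschitz boundary, surface measure and outward normal\<close>

definition drop_coord :: "'n::finite \<Rightarrow> real^'n \<Rightarrow> real^'n" where
  "drop_coord k z = (\<chi> j. if j = k then 0 else z $ j)"

(* The coordinates of y are those of T y; the Lipschitz function g depends on all of them
   except the k-th one. *)
definition lipschitz_boundary :: "(real^'n::finite) set \<Rightarrow> bool" where
  "lipschitz_boundary A \<longleftrightarrow>
     (\<forall>x\<in>frontier A. \<exists>U T k (g :: real^'n \<Rightarrow> real) L.
        open U \<and> x \<in> U \<and> orthogonal_transformation T \<and> L-lipschitz_on {z. z $ k = 0} g \<and>
        frontier A \<inter> U = {y\<in>U. T y $ k = g (drop_coord k (T y))} \<and>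
        (A \<inter> U = {y\<in>U. T y $ k < g (drop_coord k (T y))} \<or>
         A \<inter> U = {y\<in>U. T y $ k > g (drop_coord k (T y))}))"

(* Normalised so that it agrees with Lebesgue measure in d-dimensional Euclidean space. The
   library's diameter is only meaningful for bounded sets. *)
definition hausdorff_outer :: "nat \<Rightarrow> 'a::metric_space set \<Rightarrow> ennreal" where
  "hausdorff_outer d E =
     (SUP \<delta>\<in>{0<..}.
        INF C\<in>{C :: nat \<Rightarrow> 'a set. E \<subseteq> (\<Union>i. C i) \<and> (\<forall>i. bounded (C i) \<and> diameter (C i) \<le> \<delta>)}.
          \<Sum>i. if C i = {} then 0
              else ennreal (unit_ball_vol (real d) * (diameter (C i) / 2) ^ d))"

definition hausdorff_measure :: "nat \<Rightarrow> 'a::metric_space measure" where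
  "hausdorff_measure d = measure_of UNIV (sets borel) (hausdorff_outer d)"

definition surface_measure :: "(real^'n::finite) set \<Rightarrow> (real^'n) measure" where
  "surface_measure S = restrict_space (hausdorff_measure (CARD('n) - 1)) S"

(* The first limit says that nu is orthogonal to a tangent hyperplane of the boundary at x,
   i.e. that the local graph function is differentiable there; the last condition fixes the
   orientation. *)
definition is_outer_normal :: "(real^'n::finite) set \<Rightarrow> real^'n \<Rightarrow> real^'n \<Rightarrow> bool" where
  "is_outer_normal A x \<nu> \<longleftrightarrow> x \<in> frontier A \<and> norm \<nu> = 1 \<and>
     ((\<lambda>y. ((y - x) \<bullet> \<nu>) / norm (y - x)) \<longlongrightarrow> 0) (at x within frontier A) \<and>
     (\<forall>\<^sub>F t in at_right 0. x - t *\<^sub>R \<nu> \<in> A \<and> x + t *\<^sub>R \<nu> \<notin> closure A)"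

(* The value 0 is used on the null set of boundary points without a normal. *)
definition outer_normal :: "(real^'n::finite) set \<Rightarrow> real^'n \<Rightarrow> real^'n" where
  "outer_normal A x =
     (if \<exists>!\<nu>. is_outer_normal A x \<nu> then THE \<nu>. is_outer_normal A x \<nu> else 0)"

section \<open>Traces\<close>

(* The trace is the continuous extension of the restriction map from test functions to
   H^1_0(Omega). *)
definition is_trace ::
    "(real^'n::finite) set \<Rightarrow> (real^'n) set \<Rightarrow> (real^'n \<Rightarrow> real) \<Rightarrow> (real^'n \<Rightarrow> real) \<Rightarrow> bool" where
  "is_trace \<Omega> S u g \<longleftrightarrow> g \<in> L2 (surface_measure S) \<and>
     (\<forall>\<psi>. H1_approx \<Omega> \<psi> u \<longrightarrow> (\<lambda>k. LINT x|surface_measure S. (\<psi> k x - g x)\<^sup>2) \<longlonglongrightarrow> 0)"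

definition boundary_trace ::
    "(real^'n::finite) set \<Rightarrow> (real^'n) set \<Rightarrow> (real^'n \<Rightarrow> real^'n) \<Rightarrow> real^'n \<Rightarrow> real^'n" where
  "boundary_trace \<Omega> S \<phi> x = (\<chi> j. (SOME g. is_trace \<Omega> S (\<lambda>y. \<phi> y $ j) g) x)"

definition boundary_flux ::
    "(real^'n::finite) set \<Rightarrow> (real^'n) set \<Rightarrow> (real^'n \<Rightarrow> real^'n) \<Rightarrow> real" where
  "boundary_flux \<Omega> A \<phi> =
     (LINT x|surface_measure (frontier A). outer_normal A x \<bullet> boundary_trace \<Omega> (frontier A) \<phi> x)"

end

theory Submission
  imports Defs "HOL-Computational_Algebra.Polynomial"
begin

text \<open>
  By the equation for \<open>a = 1\<close>, the flux of \<open>\<phi>\<close> is \<open>\<integral>(\<nabla>s\<^sub>1 : \<nabla>\<phi>) + \<integral>(s\<^sub>1, \<phi>)\<close>.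
  Testing the equation for \<open>a\<close> with \<open>s\<^sub>a\<close>
  itself gives, for \<open>u = a s\<^sub>a\<close>,
  \<open>\<parallel>\<nabla>u\<parallel>\<^sup>2 + \<parallel>u\<parallel>\<^sup>2 / a = \<integral>(\<nabla>s\<^sub>1 : \<nabla>u) + \<integral>(s\<^sub>1, u)\<close>. Hence \<open>\<nabla>u\<close> stays bounded and
  \<open>\<parallel>u\<parallel> = O(\<surd>a)\<close>. Approximating \<open>s\<^sub>1\<close> by test functions and moving the derivative off \<open>u\<close>
  shows that the right-hand side tends to \<open>0\<close>; so \<open>\<nabla>u\<close> tends to \<open>0\<close> in \<open>L\<^sup>2\<close>, and the
  equation for \<open>a\<close> yields the limit of \<open>\<integral>(s\<^sub>a, \<phi>)\<close>.

  That weak derivatives, which are given by a choice of representative, commute with scaling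
  almost everywhere rests on the fundamental lemma of the calculus of variations. Its proof
  approximates indicators of boxes by products of dilated copies of \<open>exp (- 1 / t)\<close>.
\<close>

section \<open>Smooth bump functions\<close>

text \<open>Differentiating \<open>exp (- (1 / t))\<close> produces polynomial factors in
  \<open>1 / t\<close>; carrying \<open>p\<close> along keeps the family closed under
  differentiation.\<close>

definition flat_exp :: "real poly \<Rightarrow> real \<Rightarrow> real" where
  "flat_exp p t = (if t > 0 then poly p (1 / t) * exp (- (1 / t)) else 0)"

lemma tendsto_poly_mult_exp_minus_0: "((\<lambda>x::real. poly p x * exp (- x)) \<longlongrightarrow> 0) at_top"
proof -
  have "((\<lambda>x::real. \<Sum>i\<le>degree p. coeff p i * (x ^ i / exp x)) \<longlongrightarrow> (\<Sum>i\<le>degree p. coeff p i * 0)) at_top"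
    by (intro tendsto_sum tendsto_mult tendsto_const tendsto_power_div_exp_0)
  moreover have "(\<Sum>i\<le>degree p. coeff p i * (x ^ i / exp x)) = poly p x * exp (- x)" for x :: real
    by (simp add: poly_altdef sum_distrib_right exp_minus field_simps sum_divide_distrib)
  ultimately show ?thesis by simp
qed

text \<open>For \<open>t > 0\<close> the chain rule gives a factor \<open>1 / t ^ 2\<close>, the
  value of \<open>[:0, 0, 1:]\<close> at \<open>1 / t\<close>, and \<open>p - pderiv p\<close>
  collects the derivatives of both factors. The delicate point is \<open>t = 0\<close>.\<close>

lemma flat_exp_has_field_derivative:
  "(flat_exp p has_field_derivative flat_exp ([:0, 0, 1:] * (p - pderiv p)) t) (at t)"
proof -
  consider "t > 0" | "t < 0" | "t = 0" by linarith
  then show ?thesis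
  proof cases
    case 1
    have "((\<lambda>t. poly p (1 / t) * exp (- (1 / t))) has_field_derivative
             flat_exp ([:0, 0, 1:] * (p - pderiv p)) t) (at t)"
      using 1 by (auto intro!: derivative_eq_intros DERIV_chain2[OF poly_DERIV]
          simp: flat_exp_def field_simps power2_eq_square)
    then show ?thesis
      by (rule has_field_derivative_transform_within_open[where S = "{0<..}"])
        (use 1 in \<open>auto simp: flat_exp_def\<close>)
  next
    case 2
    have "((\<lambda>t. 0) has_field_derivative flat_exp ([:0, 0, 1:] * (p - pderiv p)) t) (at t)"
      using 2 by (simp add: flat_exp_def)
    then show ?thesis
      by (rule has_field_derivative_transform_within_open[where S = "{..<0}"])
        (use 2 in \<open>auto simp: flat_exp_def\<close>)
  next
    case 3
    \<comment> \<open>With \<open>x = 1 / h\<close> the right difference quotient at 0 is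
      \<open>x * poly p x * exp (- x)\<close>, whence the extra factor
      \<open>[:0, 1:]\<close>.\<close>
    have "((\<lambda>h. poly ([:0, 1:] * p) (inverse h) * exp (- inverse h)) \<longlongrightarrow> 0) (at_right (0::real))"
      by (rule filterlim_compose[OF tendsto_poly_mult_exp_minus_0 filterlim_inverse_at_top_right])
    moreover have "\<forall>\<^sub>F h in at_right 0.
        poly ([:0, 1:] * p) (inverse h) * exp (- inverse h) = flat_exp p h / h"
      by (rule eventually_mono[OF eventually_at_right_less[of 0]])
        (simp add: flat_exp_def field_simps)
    ultimately have "((\<lambda>h. flat_exp p h / h) \<longlongrightarrow> 0) (at_right 0)"
      by (rule Lim_transform_eventually)
    moreover have "((\<lambda>h. flat_exp p h / h) \<longlongrightarrow> 0) (at_left 0)"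
      by (rule Lim_transform_eventually[OF tendsto_const])
        (auto simp: eventually_at_left_field flat_exp_def intro!: exI[of _ "-1"])
    ultimately have "((\<lambda>h. flat_exp p h / h) \<longlongrightarrow> 0) (at 0)"
      by (simp add: filterlim_split_at)
    then show ?thesis
      using 3 by (simp add: DERIV_def flat_exp_def)
  qed
qed

text \<open>This algebra is stable under partial derivatives, so membership yields every
  \<open>Ck k\<close> by induction on \<open>k\<close>, without formulas for higher
  derivatives.\<close>

inductive_set flat_exp_algebra :: "(real^'n::finite \<Rightarrow> real) set" where
  const: "(\<lambda>x. c) \<in> flat_exp_algebra"
| flat_exp: "(\<lambda>x. flat_exp p (\<alpha> * x $ i + \<beta>)) \<in> flat_exp_algebra"
| add: "f \<in> flat_exp_algebra \<Longrightarrow> g \<in> flat_exp_algebra \<Longrightarrow> (\<lambda>x. f x + g x) \<in> flat_exp_algebra"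
| mult: "f \<in> flat_exp_algebra \<Longrightarrow> g \<in> flat_exp_algebra \<Longrightarrow> (\<lambda>x. f x * g x) \<in> flat_exp_algebra"

lemma pderiv_at_eq:
  "(f has_derivative f') (at x) \<Longrightarrow> pderiv_at i f x = f' (axis i 1)"
  unfolding pderiv_at_def by (metis frechet_derivative_at)

lemma flat_exp_algebra_differentiable:
  fixes f :: "real^'n::finite \<Rightarrow> real"
  assumes "f \<in> flat_exp_algebra"
  shows "(\<forall>x. f differentiable (at x)) \<and> (\<forall>i. pderiv_at i f \<in> flat_exp_algebra)"
  using assms
proof induction
  case (const c)
  have "pderiv_at i (\<lambda>x. c) = (\<lambda>x. 0)" for i :: 'n
    by (rule ext, subst pderiv_at_eq[OF has_derivative_const]) simp
  then show ?case by (auto intro: flat_exp_algebra.const)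
next
  case (flat_exp p \<alpha> i \<beta>)
  let ?q = "[:0, 0, 1:] * (p - pderiv p)"
  have D: "((\<lambda>x::real^'n. flat_exp p (\<alpha> * x $ i + \<beta>)) has_derivative
      (\<lambda>h. flat_exp ?q (\<alpha> * x $ i + \<beta>) * (\<alpha> * h $ i))) (at x)" for x
  proof -
    have "((\<lambda>x::real^'n. \<alpha> * x $ i + \<beta>) has_derivative (\<lambda>h. \<alpha> * h $ i)) (at x)"
      by (auto intro!: derivative_eq_intros bounded_linear.has_derivative[OF bounded_linear_vec_nth])
    from has_derivative_compose[OF this
        flat_exp_has_field_derivative[unfolded has_field_derivative_def]]
    show ?thesis .
  qed
  have "pderiv_at j (\<lambda>x::real^'n. flat_exp p (\<alpha> * x $ i + \<beta>)) =
      (\<lambda>x. flat_exp ?q (\<alpha> * x $ i + \<beta>) * (\<alpha> * axis j 1 $ i))" for j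
    by (rule ext, subst pderiv_at_eq[OF D]) simp
  with D show ?case
    by (auto simp: differentiable_def intro!: flat_exp_algebra.intros simp del: mult_pCons_left)
next
  case (add f g)
  have D: "((\<lambda>x. f x + g x) has_derivative
      (\<lambda>h. frechet_derivative f (at x) h + frechet_derivative g (at x) h)) (at x)" for x
    using add.IH by (auto intro!: has_derivative_add simp flip: frechet_derivative_works)
  have "pderiv_at i (\<lambda>x. f x + g x) = (\<lambda>x. pderiv_at i f x + pderiv_at i g x)" for i
    by (rule ext, subst pderiv_at_eq[OF D]) (simp add: pderiv_at_def)
  with D add.IH show ?case
    by (auto simp: differentiable_def intro!: flat_exp_algebra.add)
next
  case (mult f g)
  have D: "((\<lambda>x. f x * g x) has_derivative
      (\<lambda>h. f x * frechet_derivative g (at x) h + frechet_derivative f (at x) h * g x)) (at x)" for x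
    using mult.IH by (auto intro!: has_derivative_mult simp flip: frechet_derivative_works)
  have "pderiv_at i (\<lambda>x. f x * g x) = (\<lambda>x. f x * pderiv_at i g x + pderiv_at i f x * g x)" for i
    by (rule ext, subst pderiv_at_eq[OF D]) (simp add: pderiv_at_def)
  with D mult show ?case
    by (auto simp: differentiable_def intro!: flat_exp_algebra.add flat_exp_algebra.mult)
qed

lemma flat_exp_algebra_Ck: "f \<in> flat_exp_algebra \<Longrightarrow> Ck k f"
proof (induction k arbitrary: f)
  case 0
  then show ?case
    using flat_exp_algebra_differentiable[of f]
    by (auto intro!: differentiable_imp_continuous_on simp: differentiable_on_def)
next
  case (Suc k)
  then show ?case using flat_exp_algebra_differentiable[of f] by auto
qed

lemma flat_exp_algebra_prod:
  "finite I \<Longrightarrow> (\<And>i. i \<in> I \<Longrightarrow> f i \<in> flat_exp_algebra) \<Longrightarrow> (\<lambda>x. \<Prod>i\<in>I. f i x) \<in> flat_exp_algebra"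
  by (induction rule: finite_induct) (auto intro: flat_exp_algebra.intros)

text \<open>For \<open>r > 0\<close> the product is nonzero exactly on the open box, and as
  \<open>r\<close> grows each factor tends to 1 there. The arguments are expanded to match the
  generators \<open>\<alpha> * x $ i + \<beta>\<close>.\<close>

definition bump :: "real^'n::finite \<Rightarrow> real^'n \<Rightarrow> real \<Rightarrow> real^'n \<Rightarrow> real" where
  "bump c d r x = (\<Prod>j\<in>UNIV. flat_exp 1 (r * x $ j + - (r * c $ j)) * flat_exp 1 (- r * x $ j + r * d $ j))"

lemma bump_Ck: "Ck k (bump c d r)"
  unfolding bump_def[abs_def]
  by (intro flat_exp_algebra_Ck flat_exp_algebra_prod flat_exp_algebra.mult flat_exp_algebra.flat_exp) simp

lemma bump_nonzero_iff:
  assumes "r > 0" shows "bump c d r x \<noteq> 0 \<longleftrightarrow> x \<in> box c d"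
proof -
  have "flat_exp 1 (r * x $ j + - (r * c $ j)) * flat_exp 1 (- r * x $ j + r * d $ j) \<noteq> 0 \<longleftrightarrow>
      c $ j < x $ j \<and> x $ j < d $ j" for j
    using assms by (auto simp: flat_exp_def)
  then show ?thesis by (simp add: bump_def mem_box_cart)
qed

lemma bump_test_function:
  assumes "closure (box c d) \<subseteq> \<Omega>" "r > 0"
  shows "bump c d r \<in> test_functions \<Omega>"
  using assms by (simp add: test_functions_def bump_Ck bump_nonzero_iff)

lemma bump_tendsto_indicator:
  fixes c d :: "real^'n::finite"
  shows "(\<lambda>n. bump c d (real (Suc n)) x) \<longlonglongrightarrow> indicator (box c d) x"
proof (cases "x \<in> box c d")
  case True
  have lim: "(\<lambda>n. exp (- (1 / (real (Suc n) * t)))) \<longlonglongrightarrow> 1" if "t > 0" for t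
  proof -
    have "(\<lambda>n. exp (- (inverse (real (Suc n)) * inverse t))) \<longlonglongrightarrow> exp (- (0 * inverse t))"
      by (intro tendsto_intros LIMSEQ_inverse_real_of_nat)
    then show ?thesis by (simp add: divide_inverse)
  qed
  have "(\<lambda>n. \<Prod>j\<in>UNIV. exp (- (1 / (real (Suc n) * (x $ j - c $ j)))) *
      exp (- (1 / (real (Suc n) * (d $ j - x $ j))))) \<longlonglongrightarrow> (\<Prod>j\<in>(UNIV::'n set). 1 * 1)"
    by (intro tendsto_prod tendsto_mult lim) (use True in \<open>auto simp: mem_box_cart\<close>)
  moreover have "bump c d (real (Suc n)) x = (\<Prod>j\<in>UNIV. exp (- (1 / (real (Suc n) * (x $ j - c $ j)))) *
      exp (- (1 / (real (Suc n) * (d $ j - x $ j)))))" for n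
  proof -
    have "0 < real (Suc n) * (x $ j - c $ j)" "0 < real (Suc n) * (d $ j - x $ j)" for j
      using True by (auto simp: mem_box_cart)
    then have "flat_exp 1 (real (Suc n) * (x $ j - c $ j)) = exp (- (1 / (real (Suc n) * (x $ j - c $ j))))"
      "flat_exp 1 (real (Suc n) * (d $ j - x $ j)) = exp (- (1 / (real (Suc n) * (d $ j - x $ j))))" for j
      unfolding flat_exp_def by simp_all
    moreover have "r * x $ j + - (r * c $ j) = r * (x $ j - c $ j)"
      "- r * x $ j + r * d $ j = r * (d $ j - x $ j)" for r j by (simp_all add: algebra_simps)
    ultimately show ?thesis unfolding bump_def by (simp only:)
  qed
  ultimately show ?thesis using True by simp
next
  case False
  then have "bump c d (real (Suc n)) x = 0" for n using bump_nonzero_iff[of "real (Suc n)"] by (metis of_nat_0_less_iff zero_less_Suc)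
  then show ?thesis using False by simp
qed

lemma bump_bounds: "0 \<le> bump c d r x" "bump c d r x \<le> 1"
  unfolding bump_def
  by (auto intro!: prod_nonneg prod_le_1 mult_le_one simp: flat_exp_def)

section \<open>The fundamental lemma of the calculus of variations\<close>

text \<open>Boxes form an intersection-stable generator of the Borel sets, so a Dynkin argument
  carries the vanishing of the integrals from boxes to all Borel subsets of
  \<open>box a b\<close>.\<close>

lemma AE_zero_if_orthogonal_boxes:
  fixes g :: "'a::euclidean_space \<Rightarrow> real"
  assumes g: "integrable lborel g"
    and box: "\<And>c d. box c d \<subseteq> box a b \<Longrightarrow> (LINT x|lborel. indicator (box c d) x * g x) = 0"
  shows "AE x in lborel. x \<in> box a b \<longrightarrow> g x = 0"
proof -
  have int: "integrable lborel (\<lambda>x. indicator B x * g x)" if "B \<in> sets borel" for B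
    using integrable_real_mult_indicator[of B lborel g] g that by (simp add: mult.commute)
  \<comment> \<open>Cutting with \<open>box a b\<close> serves the complement step: the integral
    over the rest of \<open>box a b\<close> is a difference of two integrals already known to
    vanish.\<close>
  have zero: "(LINT x|lborel. indicator (E \<inter> box a b) x * g x) = 0" if E: "E \<in> sets borel" for E
  proof -
    have "Int_stable (range (\<lambda>(a, b). box a b :: 'a set))"
      by (auto simp: Int_stable_def box_Int_box)
    moreover have "(range (\<lambda>(a, b). box a b :: 'a set)) \<subseteq> Pow UNIV"
      by auto
    moreover have "E \<in> sigma_sets UNIV (range (\<lambda>(a, b). box a b))"
       using E unfolding borel_eq_box by simp
    ultimately show ?thesis
    proof (induction rule: sigma_sets_induct_disjoint)
      case (basic A)
      then obtain u v where "A \<inter> box a b = box u v" by (auto simp: box_Int_box)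
      then show ?case using box[of u v] by force
    next
      case empty
      then show ?case by simp
    next
      case (compl A)
      then have A: "A \<in> sets borel"
        by (simp add: borel_eq_box)
      have "(LINT x|lborel. indicator ((UNIV - A) \<inter> box a b) x * g x) =
          (LINT x|lborel. indicator (box a b) x * g x - indicator (A \<inter> box a b) x * g x)"
        by (intro Bochner_Integration.integral_cong) (auto split: split_indicator)
      also have "\<dots> = 0"
        using A compl.IH box[of a b] int by (subst Bochner_Integration.integral_diff) auto
      finally show ?case .
    next
      case (union A)
      then have A: "A i \<in> sets borel" for i
        by (auto simp: borel_eq_box)
      have "(LINT x:(\<Union>i. A i \<inter> box a b)|lborel. g x) = (\<Sum>i. LINT x:A i \<inter> box a b|lborel. g x)"
        using union.hyps(1) A int[of "\<Union>i. A i \<inter> box a b"]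
        by (intro lebesgue_integral_countable_add) (auto simp: disjoint_family_on_def set_integrable_def)
      then have "(LINT x:(\<Union>i. A i) \<inter> box a b|lborel. g x) = 0"
        using union.IH by (simp add: set_lebesgue_integral_def)
      then show ?case by (simp add: set_lebesgue_integral_def)
    qed
  qed
  have "AE x in lborel. indicator (box a b) x * g x = 0"
  proof (rule sigma_finite_measure.density_zero[OF sigma_finite_lborel])
    show "integrable lborel (\<lambda>x. indicator (box a b) x * g x)" by (rule int) simp
    fix E :: "'a set" assume "E \<in> sets lborel"
    then show "(LINT x:E|lborel. indicator (box a b) x * g x) = 0"
      using zero[of E] by (simp add: set_lebesgue_integral_def indicator_inter_arith mult.assoc)
  qed
  then show ?thesis by (auto elim: eventually_mono)
qed

text \<open>Bumps are test functions converging boundedly to indicators of boxes, so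
  \<open>f\<close> is orthogonal to every box with closure in \<open>\<Omega>\<close>, and such
  boxes detect \<open>f\<close> locally.\<close>

lemma AE_zero_if_orthogonal_test_functions:
  fixes f :: "real^'n::finite \<Rightarrow> real"
  assumes "open \<Omega>" and f: "integrable (lebesgue_on \<Omega>) f"
    and orth: "\<And>\<psi>. \<psi> \<in> test_functions \<Omega> \<Longrightarrow> (LINT x|lebesgue_on \<Omega>. f x * \<psi> x) = 0"
  shows "AE x in lebesgue_on \<Omega>. f x = 0"
proof -
  have \<Omega>: "\<Omega> \<in> sets lebesgue" using \<open>open \<Omega>\<close> by (intro sets_completionI_sets) simp
  define g where "g = (\<lambda>x. indicator \<Omega> x * f x)"
  have g: "integrable lebesgue g"
    using f \<Omega> by (simp add: g_def integrable_restrict_space)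
  \<comment> \<open>A Borel representative lets the argument on boxes run in
    \<open>lborel\<close>.\<close>
  then obtain g' where g'[measurable]: "g' \<in> borel_measurable lborel" and eq: "AE x in lborel. g x = g' x"
    using completion_ex_borel_measurable_real[of g lborel] by auto
  have eq': "AE x in lebesgue. g x = g' x" using eq by (rule AE_completion)
  have "integrable lebesgue g'"
    using g eq' integrable_cong_AE[of g lebesgue g'] by (simp add: measurable_completion borel_measurable_integrable)
  then have g'_int: "integrable lborel g'" by (simp add: integrable_completion)
  have box: "(LINT x|lborel. indicator (box c d) x * g' x) = 0" if "closure (box c d) \<subseteq> \<Omega>" for c d
  proof -
    have meas[measurable]: "bump c d r \<in> borel_measurable borel" for r
      using bump_Ck[of 0 c d r] by (auto intro: borel_measurable_continuous_onI)
    have "(LINT x|lborel. bump c d (real (Suc n)) x * g' x) = 0" for n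
    proof -
      have "(LINT x|lborel. bump c d (real (Suc n)) x * g' x) = (LINT x|lebesgue. bump c d (real (Suc n)) x * g' x)"
        by (simp add: integral_completion)
      also have "\<dots> = (LINT x|lebesgue. bump c d (real (Suc n)) x * g x)"
        using eq' g by (intro integral_cong_AE) (auto simp: measurable_completion borel_measurable_times)
      also have "\<dots> = (LINT x|lebesgue_on \<Omega>. f x * bump c d (real (Suc n)) x)"
        using \<Omega> by (simp add: integral_restrict_space g_def mult_ac)
      also have "\<dots> = 0"
        using that by (intro orth bump_test_function) auto
      finally show ?thesis .
    qed
    moreover have "(\<lambda>n. LINT x|lborel. bump c d (real (Suc n)) x * g' x) \<longlonglongrightarrow> (LINT x|lborel. indicator (box c d) x * g' x)"
    proof (rule integral_dominated_convergence[where w = "\<lambda>x. \<bar>g' x\<bar>"])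
      show "AE x in lborel. (\<lambda>n. bump c d (real (Suc n)) x * g' x) \<longlonglongrightarrow> indicator (box c d) x * g' x"
        by (intro AE_I2 tendsto_mult bump_tendsto_indicator tendsto_const)
      show "AE x in lborel. norm (bump c d (real (Suc n)) x * g' x) \<le> \<bar>g' x\<bar>" for n
        using bump_bounds[of c d "real (Suc n)"] by (intro AE_I2) (simp add: abs_mult mult_left_le_one_le)
    qed (use g'_int in auto)
    ultimately show ?thesis by (simp add: LIMSEQ_const_iff)
  qed
  \<comment> \<open>Countability keeps the union of the exceptional sets null. Since each closed box
    lies in \<open>\<Omega>\<close>, every open box inside its interior has closure in
    \<open>\<Omega>\<close>; the boundaries of the boxes are null.\<close>
  obtain \<D> where \<D>: "countable \<D>" "\<D> \<subseteq> Pow \<Omega>" "\<And>X. X \<in> \<D> \<Longrightarrow> \<exists>a b. X = cbox a b" "\<Union>\<D> = \<Omega>"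
    using open_countable_Union_open_cbox[OF \<open>open \<Omega>\<close>] by metis
  have "AE x in lebesgue. x \<in> X \<longrightarrow> g x = 0" if "X \<in> \<D>" for X
  proof -
    obtain a b where X: "X = cbox a b" using \<D> \<open>X \<in> \<D>\<close> by blast
    have "closure (box c d) \<subseteq> \<Omega>" if "box c d \<subseteq> box a b" for c d
      using closure_mono[OF that] closure_mono[OF box_subset_cbox[of a b]] X \<D>(2) \<open>X \<in> \<D>\<close>
      by (auto simp: closure_closed)
    then have "AE x in lborel. x \<in> box a b \<longrightarrow> g' x = 0"
      by (intro AE_zero_if_orthogonal_boxes g'_int box)
    then have "AE x in lebesgue. x \<in> box a b \<longrightarrow> g' x = 0" by (rule AE_completion)
    moreover have "AE x in lebesgue. x \<notin> cbox a b - box a b"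
      using negligible_frontier_interval[of a b] by (intro AE_not_in) (simp add: negligible_iff_null_sets)
    ultimately show ?thesis
      using eq' by eventually_elim (auto simp: X)
  qed
  then have "AE x in lebesgue. \<forall>X\<in>\<D>. x \<in> X \<longrightarrow> g x = 0"
    by (intro iffD2[OF AE_ball_countable[OF \<D>(1)]] ballI)
  then have "AE x in lebesgue. x \<in> \<Omega> \<longrightarrow> f x = 0"
    by eventually_elim (auto simp: g_def simp flip: \<D>(4))
  then show ?thesis using \<Omega> by (simp add: AE_restrict_space_iff)
qed

section \<open>Square-integrable functions\<close>

text \<open>Vector values are allowed, unlike in \<open>L2\<close>, so that one Cauchy-Schwarz
  inequality serves functions, vector fields and gradients.\<close>

definition sq_integrable :: "'a measure \<Rightarrow> ('a \<Rightarrow> 'b::euclidean_space) \<Rightarrow> bool" where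
  "sq_integrable M f \<longleftrightarrow> f \<in> borel_measurable M \<and> integrable M (\<lambda>x. (norm (f x))\<^sup>2)"

definition l2_norm :: "'a measure \<Rightarrow> ('a \<Rightarrow> 'b::euclidean_space) \<Rightarrow> real" where
  "l2_norm M f = sqrt (LINT x|M. (norm (f x))\<^sup>2)"

lemma L2_iff_sq_integrable: "f \<in> L2 M \<longleftrightarrow> sq_integrable M f"
  by (simp add: L2_def sq_integrable_def)

lemma l2_norm_nonneg [simp]: "0 \<le> l2_norm M f"
  by (simp add: l2_norm_def)

lemma l2_norm_square: "(l2_norm M f)\<^sup>2 = (LINT x|M. (norm (f x))\<^sup>2)"
  by (simp add: l2_norm_def)

lemma sq_integrable_measurable: "sq_integrable M f \<Longrightarrow> f \<in> borel_measurable M"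
  by (simp add: sq_integrable_def)

lemma integrable_inner:
  assumes "sq_integrable M f" "sq_integrable M g"
  shows "integrable M (\<lambda>x. f x \<bullet> g x)"
proof (rule Bochner_Integration.integrable_bound)
  show "integrable M (\<lambda>x. (norm (f x))\<^sup>2 + (norm (g x))\<^sup>2)"
    using assms by (simp add: sq_integrable_def)
  show "(\<lambda>x. f x \<bullet> g x) \<in> borel_measurable M"
    using assms by (auto simp: sq_integrable_def)
  have "\<bar>u \<bullet> v\<bar> \<le> (norm u)\<^sup>2 + (norm v)\<^sup>2" for u v :: 'b
  proof -
    have "\<bar>u \<bullet> v\<bar> \<le> norm u * norm v" by (rule Cauchy_Schwarz_ineq2)
    also have "\<dots> \<le> (norm u)\<^sup>2 + (norm v)\<^sup>2"
      using sum_squares_bound[of "norm u" "norm v"] mult_nonneg_nonneg[OF norm_ge_zero norm_ge_zero, of u v]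
      by linarith
    finally show ?thesis .
  qed
  then show "AE x in M. norm (f x \<bullet> g x) \<le> norm ((norm (f x))\<^sup>2 + (norm (g x))\<^sup>2)"
    by (auto intro: order_trans[OF _ abs_ge_self])
qed

lemma integrable_mult:
  fixes f g :: "'a \<Rightarrow> real"
  shows "sq_integrable M f \<Longrightarrow> sq_integrable M g \<Longrightarrow> integrable M (\<lambda>x. f x * g x)"
  using integrable_inner[of M f g] by simp

lemma sq_integrable_scaleR:
  "sq_integrable M f \<Longrightarrow> sq_integrable M (\<lambda>x. c *\<^sub>R f x)"
  by (auto simp: sq_integrable_def power_mult_distrib)

lemma power2_norm_diff: "(norm (u - c *\<^sub>R v))\<^sup>2 = (norm u)\<^sup>2 - 2 * c * (u \<bullet> v) + c\<^sup>2 * (norm v)\<^sup>2"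
  for u v :: "'a::real_inner"
  unfolding power2_norm_eq_inner power2_eq_square[of c]
  by (simp add: inner_diff_left inner_diff_right inner_commute algebra_simps)

lemma sq_integrable_diff_scaleR:
  assumes "sq_integrable M f" "sq_integrable M g"
  shows "sq_integrable M (\<lambda>x. f x - c *\<^sub>R g x)"
  using assms integrable_inner[OF assms]
  by (auto simp: sq_integrable_def power2_norm_diff mult.assoc)

lemma sq_integrable_diff:
  assumes "sq_integrable M f" "sq_integrable M g"
  shows "sq_integrable M (\<lambda>x. f x - g x)"
  using sq_integrable_diff_scaleR[OF assms, of 1] by simp

text \<open>Discriminant argument: the squared norm of \<open>f - c g\<close> is a nonnegative
  quadratic polynomial in \<open>c\<close>.\<close>

lemma l2_Cauchy_Schwarz:
  assumes f: "sq_integrable M f" and g: "sq_integrable M g"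
  shows "\<bar>LINT x|M. f x \<bullet> g x\<bar> \<le> l2_norm M f * l2_norm M g"
proof -
  define F G X where "F = (LINT x|M. (norm (f x))\<^sup>2)" and "G = (LINT x|M. (norm (g x))\<^sup>2)"
    and "X = (LINT x|M. f x \<bullet> g x)"
  have nonneg: "0 \<le> F - 2 * c * X + c\<^sup>2 * G" for c
  proof -
    have "0 \<le> (LINT x|M. (norm (f x - c *\<^sub>R g x))\<^sup>2)" by simp
    also have "\<dots> = F - 2 * c * X + c\<^sup>2 * G"
      using f g integrable_inner[OF f g]
      by (simp add: power2_norm_diff F_def G_def X_def sq_integrable_def mult.assoc)
    finally show ?thesis .
  qed
  have "F \<ge> 0" "G \<ge> 0" by (simp_all add: F_def G_def)
  have "X\<^sup>2 \<le> F * G"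
  proof (cases "G = 0")
    case True
    have "X = 0"
    proof (rule ccontr)
      assume "X \<noteq> 0"
      \<comment> \<open>For \<open>G = 0\<close> this choice of \<open>c\<close> gives the value
        \<open>F - (F + 1) = -1\<close>.\<close>
      then show False using nonneg[of "(F + 1) / (2 * X)"] True by simp
    qed
    then show ?thesis using True by simp
  next
    case False
    \<comment> \<open>\<open>c = X / G\<close> minimises the quadratic.\<close>
    then have "0 \<le> F - X\<^sup>2 / G"
      using nonneg[of "X / G"] by (simp add: power2_eq_square)
    then show ?thesis using False \<open>G \<ge> 0\<close> by (simp add: field_simps)
  qed
  then have "\<bar>X\<bar> \<le> sqrt (F * G)" by (metis real_sqrt_abs real_sqrt_le_mono)
  then show ?thesis by (simp add: l2_norm_def F_def G_def X_def real_sqrt_mult)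
qed

lemma borel_measurable_vec_componentwise:
  fixes f :: "'a \<Rightarrow> 'b::euclidean_space^'n"
  assumes "\<And>i. (\<lambda>x. f x $ i) \<in> borel_measurable M"
  shows "f \<in> borel_measurable M"
  using assms by (subst borel_measurable_euclidean_space) (auto simp: Basis_vec_def inner_axis)

lemma power2_norm_vec: "(norm v)\<^sup>2 = (\<Sum>i\<in>UNIV. (norm (v $ i))\<^sup>2)"
  for v :: "'b::euclidean_space^'n"
  by (simp add: power2_norm_eq_inner inner_vec_def)

lemma sq_integrable_vec:
  fixes f :: "'a \<Rightarrow> 'b::euclidean_space^'n"
  assumes "\<And>i. sq_integrable M (\<lambda>x. f x $ i)"
  shows "sq_integrable M f"
  using assms by (auto simp: sq_integrable_def power2_norm_vec intro!: borel_measurable_vec_componentwise)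

lemma l2_norm_nth_le:
  fixes f :: "'a \<Rightarrow> 'b::euclidean_space^'n"
  assumes "sq_integrable M f" and "sq_integrable M (\<lambda>x. f x $ i)"
  shows "l2_norm M (\<lambda>x. f x $ i) \<le> l2_norm M f"
  unfolding l2_norm_def
  using assms by (intro real_sqrt_le_mono integral_mono power_mono Finite_Cartesian_Product.norm_nth_le)
    (auto simp: sq_integrable_def)

section \<open>Sobolev functions on a bounded domain\<close>

text \<open>Makes the general square-integrability lemmas available for gradients.\<close>

lemma HS_inner_eq_inner: "HS_inner P Q = P \<bullet> Q"
  unfolding HS_inner_def trace_def matrix_matrix_mult_def transpose_def inner_vec_def
  by (simp add: sum.swap[of "\<lambda>i k. P $ k $ i * Q $ k $ i"])

section \<open>Closure properties of test functions\<close>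

lemma test_functions_Ck: "\<psi> \<in> test_functions \<Omega> \<Longrightarrow> Ck k \<psi>"
  by (simp add: test_functions_def)

lemma test_functions_differentiable: "\<psi> \<in> test_functions \<Omega> \<Longrightarrow> \<psi> differentiable (at x)"
  using test_functions_Ck[of \<psi> \<Omega> "Suc 0"] by simp

text \<open>Off its closed support \<open>\<psi>\<close> vanishes on a whole neighbourhood, so
  differentiation does not enlarge the support.\<close>

lemma test_functions_pderiv_at:
  assumes "\<psi> \<in> test_functions \<Omega>"
  shows "pderiv_at i \<psi> \<in> test_functions \<Omega>"
proof -
  have Ck: "Ck k (pderiv_at i \<psi>)" for k
    using test_functions_Ck[OF assms, of "Suc k"] by simp
  have "pderiv_at i \<psi> x = 0" if "x \<notin> closure {x. \<psi> x \<noteq> 0}" for x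
  proof -
    have "(\<psi> has_derivative (\<lambda>h. 0)) (at x)"
    proof (rule has_derivative_transform_within_open)
      show "((\<lambda>x. 0::real) has_derivative (\<lambda>h. 0)) (at x)" by simp
      show "open (- closure {x. \<psi> x \<noteq> 0})" by (rule open_Compl[OF closed_closure])
      show "x \<in> - closure {x. \<psi> x \<noteq> 0}" using that by simp
      show "0 = \<psi> y" if "y \<in> - closure {x. \<psi> x \<noteq> 0}" for y
        using that closure_subset[of "{x. \<psi> x \<noteq> 0}"] by auto
    qed
    then show ?thesis by (simp add: pderiv_at_eq)
  qed
  then have "{x. pderiv_at i \<psi> x \<noteq> 0} \<subseteq> closure {x. \<psi> x \<noteq> 0}" by auto
  then have sub: "closure {x. pderiv_at i \<psi> x \<noteq> 0} \<subseteq> closure {x. \<psi> x \<noteq> 0}"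
    by (simp add: closure_minimal)
  then have "compact (closure {x. pderiv_at i \<psi> x \<noteq> 0})"
    using assms compact_closure bounded_subset unfolding test_functions_def
    by (metis (mono_tags, lifting) bounded_closure_image closure_closure closure_subset mem_Collect_eq compact_imp_bounded)
  then show ?thesis using Ck sub assms by (auto simp: test_functions_def)
qed

lemma pderiv_at_cmult:
  assumes "\<And>x. f differentiable (at x)"
  shows "pderiv_at i (\<lambda>x. c * f x) = (\<lambda>x. c * pderiv_at i f x)"
proof
  fix x
  have "(f has_derivative frechet_derivative f (at x)) (at x)"
    using assms by (simp flip: frechet_derivative_works)
  then have "((\<lambda>x. c * f x) has_derivative (\<lambda>h. c * frechet_derivative f (at x) h)) (at x)"
    by (rule has_derivative_mult_right)
  from pderiv_at_eq[OF this] show "pderiv_at i (\<lambda>x. c * f x) x = c * pderiv_at i f x"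
    by (simp add: pderiv_at_def)
qed

lemma Ck_cmult: "Ck k f \<Longrightarrow> Ck k (\<lambda>x. c * f x)"
proof (induction k arbitrary: f)
  case 0
  then show ?case by (auto intro!: continuous_intros)
next
  case (Suc k)
  then show ?case by (auto simp: pderiv_at_cmult)
qed

lemma test_functions_cmult:
  assumes "\<psi> \<in> test_functions \<Omega>"
  shows "(\<lambda>x. c * \<psi> x) \<in> test_functions \<Omega>"
\<comment> \<open>For \<open>c = 0\<close> the support becomes empty instead of staying the
  same.\<close>
proof (cases "c = 0")
  case True
  then show ?thesis using Ck_cmult[OF test_functions_Ck[OF assms], of _ 0]
    by (simp add: test_functions_def)
next
  case False
  then have "{x. c * \<psi> x \<noteq> 0} = {x. \<psi> x \<noteq> 0}" by auto
  then show ?thesis using assms by (auto simp: test_functions_def intro: Ck_cmult)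
qed

locale bounded_domain =
  fixes \<Omega> :: "(real^'n::finite) set"
  assumes open_domain: "open \<Omega>" and bounded_domain: "bounded \<Omega>"
begin

lemma domain_lebesgue: "\<Omega> \<in> sets lebesgue"
  using open_domain by (intro sets_completionI_sets) simp

sublocale finite_measure "lebesgue_on \<Omega>"
  using lmeasurable_open[OF bounded_domain open_domain] by (rule finite_measure_lebesgue_on)

text \<open>Pair \<open>f\<close> with the constant 1, which is square integrable because
  \<open>\<Omega>\<close> has finite measure.\<close>

lemma sq_integrable_imp_integrable:
  fixes f :: "real^'n \<Rightarrow> real"
  shows "sq_integrable (lebesgue_on \<Omega>) f \<Longrightarrow> integrable (lebesgue_on \<Omega>) f"
  using integrable_mult[of "lebesgue_on \<Omega>" f "\<lambda>x. 1"] by (simp add: sq_integrable_def)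

lemma sq_integrable_test_function:
  assumes "\<psi> \<in> test_functions \<Omega>"
  shows "sq_integrable (lebesgue_on \<Omega>) \<psi>"
proof -
  have cont: "continuous_on S \<psi>" for S
    using test_functions_Ck[OF assms, of 0] continuous_on_subset by auto
  then have meas: "\<psi> \<in> borel_measurable (lebesgue_on \<Omega>)"
    by (intro continuous_imp_measurable_on_sets_lebesgue domain_lebesgue)
  have "bounded (\<psi> ` closure \<Omega>)"
    using bounded_domain cont by (intro compact_imp_bounded compact_continuous_image) auto
  then obtain B where B: "\<And>x. x \<in> \<Omega> \<Longrightarrow> \<bar>\<psi> x\<bar> \<le> B"
    using closure_subset by (fastforce simp: bounded_iff)
  have "integrable (lebesgue_on \<Omega>) (\<lambda>x. (\<psi> x)\<^sup>2)"
  proof (rule integrable_const_bound)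
    show "AE x in lebesgue_on \<Omega>. norm ((\<psi> x)\<^sup>2) \<le> B\<^sup>2"
      using B by (intro AE_I2) (auto simp: abs_le_square_iff[symmetric] intro: order_trans[OF _ abs_ge_self])
  qed (use meas in simp)
  with meas show ?thesis by (simp add: sq_integrable_def)
qed

section \<open>Weak derivatives and scalar multiples\<close>

lemma weak_pderiv_sq_integrable:
  "is_weak_pderiv \<Omega> i u v \<Longrightarrow> sq_integrable (lebesgue_on \<Omega>) v"
  by (simp add: is_weak_pderiv_def L2_iff_sq_integrable)

text \<open>Both candidates have the same integral against each test function, so the fundamental
  lemma applies to their difference.\<close>

lemma is_weak_pderiv_unique:
  assumes v: "is_weak_pderiv \<Omega> i u v" and w: "is_weak_pderiv \<Omega> i u w"
  shows "AE x in lebesgue_on \<Omega>. v x = w x"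
proof -
  note sq = weak_pderiv_sq_integrable[OF v] weak_pderiv_sq_integrable[OF w]
  have "AE x in lebesgue_on \<Omega>. v x - w x = 0"
  proof (rule AE_zero_if_orthogonal_test_functions[OF open_domain])
    show "integrable (lebesgue_on \<Omega>) (\<lambda>x. v x - w x)"
      by (intro Bochner_Integration.integrable_diff sq_integrable_imp_integrable sq)
    fix \<psi> assume \<psi>: "\<psi> \<in> test_functions \<Omega>"
    note int = integrable_mult[OF sq(1) sq_integrable_test_function[OF \<psi>]]
      integrable_mult[OF sq(2) sq_integrable_test_function[OF \<psi>]]
    show "(LINT x|lebesgue_on \<Omega>. (v x - w x) * \<psi> x) = 0"
      using v w \<psi> int by (simp add: left_diff_distrib is_weak_pderiv_def)
  qed
  then show ?thesis by simp
qed

lemma is_weak_pderiv_cmult: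
  assumes "is_weak_pderiv \<Omega> i u v"
  shows "is_weak_pderiv \<Omega> i (\<lambda>x. c * u x) (\<lambda>x. c * v x)"
  using assms sq_integrable_scaleR[OF weak_pderiv_sq_integrable[OF assms], of c]
  by (simp add: is_weak_pderiv_def mult.assoc L2_iff_sq_integrable)

lemma H1_sq_integrable: "u \<in> H1 \<Omega> \<Longrightarrow> sq_integrable (lebesgue_on \<Omega>) u"
  by (simp add: H1_def L2_iff_sq_integrable)

lemma H1_weak_pderiv: "u \<in> H1 \<Omega> \<Longrightarrow> is_weak_pderiv \<Omega> i u (weak_pderiv \<Omega> i u)"
  by (simp add: H1_def weak_pderiv_def someI_ex)

lemma H1_weak_pderiv_sq_integrable:
  "u \<in> H1 \<Omega> \<Longrightarrow> sq_integrable (lebesgue_on \<Omega>) (weak_pderiv \<Omega> i u)"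
  by (rule weak_pderiv_sq_integrable[OF H1_weak_pderiv])

lemma H1_cmult:
  assumes "u \<in> H1 \<Omega>" shows "(\<lambda>x. c * u x) \<in> H1 \<Omega>"
  using assms sq_integrable_scaleR[OF H1_sq_integrable[OF assms], of c] is_weak_pderiv_cmult[of _ u _ c]
  by (fastforce simp: H1_def L2_iff_sq_integrable)

text \<open>The representatives are chosen independently for \<open>u\<close> and for its multiple,
  so uniqueness gives agreement only almost everywhere.\<close>

lemma weak_pderiv_cmult:
  assumes "u \<in> H1 \<Omega>"
  shows "AE x in lebesgue_on \<Omega>. weak_pderiv \<Omega> i (\<lambda>y. c * u y) x = c * weak_pderiv \<Omega> i u x"
  by (rule is_weak_pderiv_unique[OF H1_weak_pderiv[OF H1_cmult[OF assms]]
        is_weak_pderiv_cmult[OF H1_weak_pderiv[OF assms]]])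

lemma H10_imp_H1: "u \<in> H10 \<Omega> \<Longrightarrow> u \<in> H1 \<Omega>"
  by (simp add: H10_def)

text \<open>Scaling an approximating sequence by \<open>c\<close> multiplies each squared error by
  \<open>c ^ 2\<close>.\<close>

lemma H10_cmult:
  assumes "u \<in> H10 \<Omega>" shows "(\<lambda>x. c * u x) \<in> H10 \<Omega>"
proof -
  obtain \<psi> where \<psi>: "H1_approx \<Omega> \<psi> u" using assms by (auto simp: H10_def)
  have test: "\<psi> k \<in> test_functions \<Omega>" for k using \<psi> by (simp add: H1_approx_def)
  note H1 = H10_imp_H1[OF assms]
  have "(\<lambda>k. LINT x|lebesgue_on \<Omega>. (c * \<psi> k x - c * u x)\<^sup>2) =
      (\<lambda>k. c\<^sup>2 * (LINT x|lebesgue_on \<Omega>. (\<psi> k x - u x)\<^sup>2))"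
    by (simp add: power_mult_distrib flip: right_diff_distrib)
  moreover have "(\<lambda>k. c\<^sup>2 * (LINT x|lebesgue_on \<Omega>. (\<psi> k x - u x)\<^sup>2)) \<longlonglongrightarrow> c\<^sup>2 * 0"
    using \<psi> by (intro tendsto_mult tendsto_const) (simp add: H1_approx_def)
  moreover have "(\<lambda>k. LINT x|lebesgue_on \<Omega>. (pderiv_at i (\<lambda>x. c * \<psi> k x) x - weak_pderiv \<Omega> i (\<lambda>x. c * u x) x)\<^sup>2)
      \<longlonglongrightarrow> 0" for i
  proof -
    have meas [measurable]: "pderiv_at i (\<psi> k) \<in> borel_measurable (lebesgue_on \<Omega>)"
      "weak_pderiv \<Omega> i u \<in> borel_measurable (lebesgue_on \<Omega>)"
      "weak_pderiv \<Omega> i (\<lambda>x. c * u x) \<in> borel_measurable (lebesgue_on \<Omega>)" for k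
      using sq_integrable_test_function[OF test_functions_pderiv_at[OF test]]
        H1_weak_pderiv_sq_integrable[OF H1] H1_weak_pderiv_sq_integrable[OF H1_cmult[OF H1]]
      by (blast intro: sq_integrable_measurable)+
    have "(LINT x|lebesgue_on \<Omega>. (pderiv_at i (\<lambda>x. c * \<psi> k x) x - weak_pderiv \<Omega> i (\<lambda>x. c * u x) x)\<^sup>2) =
        (LINT x|lebesgue_on \<Omega>. (c * pderiv_at i (\<psi> k) x - c * weak_pderiv \<Omega> i u x)\<^sup>2)" for k
      unfolding pderiv_at_cmult[OF test_functions_differentiable[OF test]]
    proof (rule integral_cong_AE)
      show "AE x in lebesgue_on \<Omega>. (c * pderiv_at i (\<psi> k) x - weak_pderiv \<Omega> i (\<lambda>x. c * u x) x)\<^sup>2 =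
          (c * pderiv_at i (\<psi> k) x - c * weak_pderiv \<Omega> i u x)\<^sup>2"
        using weak_pderiv_cmult[OF H1, of i c] by eventually_elim simp
    qed measurable
    then have "(LINT x|lebesgue_on \<Omega>. (pderiv_at i (\<lambda>x. c * \<psi> k x) x - weak_pderiv \<Omega> i (\<lambda>x. c * u x) x)\<^sup>2) =
        c\<^sup>2 * (LINT x|lebesgue_on \<Omega>. (pderiv_at i (\<psi> k) x - weak_pderiv \<Omega> i u x)\<^sup>2)" for k
      by (simp add: power_mult_distrib flip: right_diff_distrib)
    moreover have "(\<lambda>k. c\<^sup>2 * (LINT x|lebesgue_on \<Omega>. (pderiv_at i (\<psi> k) x - weak_pderiv \<Omega> i u x)\<^sup>2))
        \<longlonglongrightarrow> c\<^sup>2 * 0"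
      using \<psi> by (intro tendsto_mult tendsto_const) (simp add: H1_approx_def)
    ultimately show ?thesis by simp
  qed
  ultimately have "H1_approx \<Omega> (\<lambda>k x. c * \<psi> k x) (\<lambda>x. c * u x)"
    using test by (auto simp: H1_approx_def intro: test_functions_cmult)
  then show ?thesis using H1_cmult[OF H1] by (auto simp: H10_def)
qed

text \<open>
  Replacing \<open>w\<close> by a nearby test function moves the derivative off \<open>v\<close>, so that up to a
  small multiple of the norm of \<open>\<partial>\<^sub>i v\<close> only the \<open>L\<^sup>2\<close> norm of \<open>v\<close> itself enters.
\<close>
lemma weak_pderiv_inner_bound:
  assumes w: "w \<in> H10 \<Omega>" and "\<epsilon> > 0"
  shows "\<exists>C\<ge>0. \<forall>v\<in>H1 \<Omega>. \<bar>LINT x|lebesgue_on \<Omega>. weak_pderiv \<Omega> i w x * weak_pderiv \<Omega> i v x\<bar>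
      \<le> \<epsilon> * l2_norm (lebesgue_on \<Omega>) (weak_pderiv \<Omega> i v) + C * l2_norm (lebesgue_on \<Omega>) v"
proof -
  let ?M = "lebesgue_on \<Omega>"
  obtain \<psi>s where \<psi>s: "H1_approx \<Omega> \<psi>s w" using w by (auto simp: H10_def)
  then have "(\<lambda>k. LINT x|?M. (pderiv_at i (\<psi>s k) x - weak_pderiv \<Omega> i w x)\<^sup>2) \<longlonglongrightarrow> 0"
    by (simp add: H1_approx_def)
  then have "\<forall>\<^sub>F k in sequentially. (LINT x|?M. (pderiv_at i (\<psi>s k) x - weak_pderiv \<Omega> i w x)\<^sup>2) < \<epsilon>\<^sup>2"
    using \<open>\<epsilon> > 0\<close> by (intro order_tendstoD) auto
  then obtain k where k: "(LINT x|?M. (pderiv_at i (\<psi>s k) x - weak_pderiv \<Omega> i w x)\<^sup>2) < \<epsilon>\<^sup>2"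
    by (auto simp: eventually_sequentially)
  define \<psi> where "\<psi> = \<psi>s k"
  have test: "\<psi> \<in> test_functions \<Omega>" using \<psi>s by (simp add: \<psi>_def H1_approx_def)
  note test1 = test_functions_pderiv_at[OF test, of i]
  note sq\<psi> = sq_integrable_test_function[OF test1]
    sq_integrable_test_function[OF test_functions_pderiv_at[OF test1, of i]]
  note sqw = H1_weak_pderiv_sq_integrable[OF H10_imp_H1[OF w], of i]
  note sqd = sq_integrable_diff[OF sqw sq\<psi>(1)]
  have small: "l2_norm ?M (\<lambda>x. weak_pderiv \<Omega> i w x - pderiv_at i \<psi> x) \<le> \<epsilon>"
    using k \<open>\<epsilon> > 0\<close> unfolding l2_norm_def \<psi>_def
    by (intro real_le_lsqrt) (auto simp: power2_commute)
  \<comment> \<open>The constant depends on \<open>\<psi>\<close>, hence on \<open>w\<close>,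
    \<open>i\<close> and \<open>\<epsilon>\<close>, but not on \<open>v\<close>.\<close>
  let ?C = "l2_norm ?M (pderiv_at i (pderiv_at i \<psi>))"
  have "\<bar>LINT x|?M. weak_pderiv \<Omega> i w x * weak_pderiv \<Omega> i v x\<bar>
      \<le> \<epsilon> * l2_norm ?M (weak_pderiv \<Omega> i v) + ?C * l2_norm ?M v" if v: "v \<in> H1 \<Omega>" for v
  proof -
    note sqv = H1_weak_pderiv_sq_integrable[OF v, of i]
    \<comment> \<open>The first summand is small by the choice of \<open>\<psi>\<close>. In the
      second, \<open>pderiv_at i \<psi>\<close> is itself a test function, so the derivative on
      \<open>v\<close> moves over to it.\<close>
    have "(LINT x|?M. weak_pderiv \<Omega> i w x * weak_pderiv \<Omega> i v x) =
        (LINT x|?M. (weak_pderiv \<Omega> i w x - pderiv_at i \<psi> x) * weak_pderiv \<Omega> i v x)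
        + (LINT x|?M. weak_pderiv \<Omega> i v x * pderiv_at i \<psi> x)"
      by (subst Bochner_Integration.integral_add[symmetric])
        (use integrable_mult[OF sqd sqv] integrable_mult[OF sqv sq\<psi>(1)] in \<open>auto simp: algebra_simps\<close>)
    moreover have "(LINT x|?M. weak_pderiv \<Omega> i v x * pderiv_at i \<psi> x) =
        - (LINT x|?M. pderiv_at i (pderiv_at i \<psi>) x * v x)"
      using H1_weak_pderiv[OF v, of i] test1 by (simp add: is_weak_pderiv_def mult.commute)
    moreover have "\<bar>LINT x|?M. (weak_pderiv \<Omega> i w x - pderiv_at i \<psi> x) * weak_pderiv \<Omega> i v x\<bar>
        \<le> \<epsilon> * l2_norm ?M (weak_pderiv \<Omega> i v)"
      using l2_Cauchy_Schwarz[OF sqd sqv] mult_right_mono[OF small l2_norm_nonneg]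
      by (fastforce intro: order_trans)
    moreover have "\<bar>LINT x|?M. pderiv_at i (pderiv_at i \<psi>) x * v x\<bar> \<le> ?C * l2_norm ?M v"
      using l2_Cauchy_Schwarz[OF sq\<psi>(2) H1_sq_integrable[OF v]] by simp
    ultimately show ?thesis by linarith
  qed
  then show ?thesis by (intro exI[of _ ?C]) simp
qed

section \<open>Vector fields and their gradients\<close>

lemma H10_vec_sq_integrable: "\<phi> \<in> H10_vec \<Omega> \<Longrightarrow> sq_integrable (lebesgue_on \<Omega>) \<phi>"
  by (auto intro!: sq_integrable_vec H1_sq_integrable H10_imp_H1 simp: H10_vec_def)

lemma weak_grad_sq_integrable: "\<phi> \<in> H10_vec \<Omega> \<Longrightarrow> sq_integrable (lebesgue_on \<Omega>) (weak_grad \<Omega> \<phi>)"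
  by (auto intro!: sq_integrable_vec H1_weak_pderiv_sq_integrable H10_imp_H1 simp: H10_vec_def weak_grad_def)

lemma H10_vec_scaleR: "\<phi> \<in> H10_vec \<Omega> \<Longrightarrow> (\<lambda>x. c *\<^sub>R \<phi> x) \<in> H10_vec \<Omega>"
  by (simp add: H10_vec_def H10_cmult)

lemma H10_norm_eq: "H10_norm \<Omega> \<phi> = l2_norm (lebesgue_on \<Omega>) (weak_grad \<Omega> \<phi>)"
  by (simp add: H10_norm_def H10_inner_def l2_norm_def HS_inner_eq_inner power2_norm_eq_inner)

text \<open>The entries of the two gradients agree almost everywhere, and there are finitely many of
  them, so the exceptional null sets can be merged.\<close>

lemma H10_norm_scaleR:
  assumes "\<phi> \<in> H10_vec \<Omega>"
  shows "H10_norm \<Omega> (\<lambda>x. c *\<^sub>R \<phi> x) = \<bar>c\<bar> * H10_norm \<Omega> \<phi>"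
proof -
  let ?M = "lebesgue_on \<Omega>"
  have "AE x in ?M. \<forall>i\<in>UNIV. \<forall>j\<in>UNIV.
      weak_pderiv \<Omega> i (\<lambda>y. c * \<phi> y $ j) x = c * weak_pderiv \<Omega> i (\<lambda>y. \<phi> y $ j) x"
    using assms by (intro AE_finite_allI weak_pderiv_cmult H10_imp_H1) (auto simp: H10_vec_def)
  then have "AE x in ?M. weak_grad \<Omega> (\<lambda>x. c *\<^sub>R \<phi> x) x = c *\<^sub>R weak_grad \<Omega> \<phi> x"
    by eventually_elim (simp add: weak_grad_def vec_eq_iff)
  then have "(LINT x|?M. (norm (weak_grad \<Omega> (\<lambda>x. c *\<^sub>R \<phi> x) x))\<^sup>2) = (LINT x|?M. (norm (c *\<^sub>R weak_grad \<Omega> \<phi> x))\<^sup>2)"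
    using weak_grad_sq_integrable[OF assms] weak_grad_sq_integrable[OF H10_vec_scaleR[OF assms]]
    by (intro integral_cong_AE) (auto simp: sq_integrable_def elim!: eventually_mono)
  then show ?thesis
    by (simp add: H10_norm_eq l2_norm_def power_mult_distrib real_sqrt_mult)
qed

text \<open>The scalar bound is applied to each of the \<open>?N\<close> entries of the gradient,
  every entry receiving the share \<open>\<epsilon> / ?N\<close>.\<close>

lemma weak_grad_inner_bound:
  assumes \<phi>: "\<phi> \<in> H10_vec \<Omega>" and "\<epsilon> > 0"
  shows "\<exists>C\<ge>0. \<forall>\<eta>\<in>H10_vec \<Omega>. \<bar>LINT x|lebesgue_on \<Omega>. weak_grad \<Omega> \<phi> x \<bullet> weak_grad \<Omega> \<eta> x\<bar>
      \<le> \<epsilon> * l2_norm (lebesgue_on \<Omega>) (weak_grad \<Omega> \<eta>) + C * l2_norm (lebesgue_on \<Omega>) \<eta>"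
proof -
  let ?M = "lebesgue_on \<Omega>" and ?N = "(of_nat CARD('n))\<^sup>2 :: real"
  let ?d = "\<lambda>i j \<phi>. weak_pderiv \<Omega> i (\<lambda>y. \<phi> y $ j)"
  have "\<epsilon> / ?N > 0" using \<open>\<epsilon> > 0\<close> by simp
  \<comment> \<open>Bundling both properties of the constant allows one choice of a whole family
    \<open>C i j\<close>.\<close>
  define Q where "Q i j C \<longleftrightarrow> C \<ge> 0 \<and> (\<forall>v\<in>H1 \<Omega>. \<bar>LINT x|?M. ?d i j \<phi> x * weak_pderiv \<Omega> i v x\<bar>
      \<le> \<epsilon> / ?N * l2_norm ?M (weak_pderiv \<Omega> i v) + C * l2_norm ?M v)" for i j C
  have "\<exists>C. Q i j C" for i j
    unfolding Q_def using \<phi> \<open>\<epsilon> / ?N > 0\<close> by (intro weak_pderiv_inner_bound) (auto simp: H10_vec_def)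
  then obtain C where "\<And>i j. Q i j (C i j)" by metis
  then have C0: "\<And>i j. C i j \<ge> 0" and C: "\<And>i j v. v \<in> H1 \<Omega> \<Longrightarrow>
      \<bar>LINT x|?M. ?d i j \<phi> x * weak_pderiv \<Omega> i v x\<bar> \<le> \<epsilon> / ?N * l2_norm ?M (weak_pderiv \<Omega> i v) + C i j * l2_norm ?M v"
    by (auto simp: Q_def)
  have "\<bar>LINT x|?M. weak_grad \<Omega> \<phi> x \<bullet> weak_grad \<Omega> \<eta> x\<bar>
      \<le> \<epsilon> * l2_norm ?M (weak_grad \<Omega> \<eta>) + (\<Sum>i\<in>UNIV. \<Sum>j\<in>UNIV. C i j) * l2_norm ?M \<eta>"
    if \<eta>: "\<eta> \<in> H10_vec \<Omega>" for \<eta>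
  proof -
    have H1: "(\<lambda>y. \<phi> y $ j) \<in> H1 \<Omega>" "(\<lambda>y. \<eta> y $ j) \<in> H1 \<Omega>" for j
      using \<phi> \<eta> by (auto simp: H10_vec_def H10_imp_H1)
    note sq = H1_weak_pderiv_sq_integrable[OF H1(1)] H1_weak_pderiv_sq_integrable[OF H1(2)]
    have row: "sq_integrable ?M (\<lambda>x. weak_grad \<Omega> \<eta> x $ i)" for i
      using sq(2) by (intro sq_integrable_vec) (simp add: weak_grad_def)
    have grad_le: "l2_norm ?M (?d i j \<eta>) \<le> l2_norm ?M (weak_grad \<Omega> \<eta>)" for i j
      using l2_norm_nth_le[OF weak_grad_sq_integrable[OF \<eta>] row, of i] l2_norm_nth_le[OF row, of i j] sq(2)[of i j]
      by (simp add: weak_grad_def[abs_def])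
    have le: "l2_norm ?M (\<lambda>y. \<eta> y $ j) \<le> l2_norm ?M \<eta>" for j
      by (rule l2_norm_nth_le[OF H10_vec_sq_integrable[OF \<eta>] H1_sq_integrable[OF H1(2)]])
    have "(LINT x|?M. weak_grad \<Omega> \<phi> x \<bullet> weak_grad \<Omega> \<eta> x) =
        (\<Sum>i\<in>UNIV. \<Sum>j\<in>UNIV. LINT x|?M. ?d i j \<phi> x * ?d i j \<eta> x)"
      using integrable_mult[OF sq] by (simp add: weak_grad_def inner_vec_def)
    also have "\<bar>\<dots>\<bar> \<le> (\<Sum>i\<in>UNIV. \<Sum>j\<in>UNIV. \<epsilon> / ?N * l2_norm ?M (weak_grad \<Omega> \<eta>) + C i j * l2_norm ?M \<eta>)"
    proof (intro order_trans[OF sum_abs] sum_mono)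
      fix i j
      show "\<bar>LINT x|?M. ?d i j \<phi> x * ?d i j \<eta> x\<bar> \<le> \<epsilon> / ?N * l2_norm ?M (weak_grad \<Omega> \<eta>) + C i j * l2_norm ?M \<eta>"
        by (rule order_trans[OF C[OF H1(2)] add_mono[OF mult_left_mono[OF grad_le] mult_left_mono[OF le C0]]])
          (use \<open>\<epsilon> / ?N > 0\<close> in simp)
    qed
    also have "\<dots> = \<epsilon> * l2_norm ?M (weak_grad \<Omega> \<eta>) + (\<Sum>i\<in>UNIV. \<Sum>j\<in>UNIV. C i j) * l2_norm ?M \<eta>"
      by (simp add: sum.distrib sum_distrib_right power2_eq_square)
    finally show ?thesis .
  qed
  moreover have "(\<Sum>i\<in>UNIV. \<Sum>j\<in>UNIV. C i j) \<ge> 0" by (intro sum_nonneg C0)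
  ultimately show ?thesis by blast
qed

end

section \<open>The singular limit\<close>

text \<open>
  In the application \<open>p\<close> and \<open>g\<close> are the \<open>L\<^sup>2\<close> norms of the solution and of its gradient, and
  \<open>X\<close> is the inner product of the latter with a fixed gradient.
\<close>
lemma energy_tendsto_0:
  fixes g p X :: "real \<Rightarrow> real"
  assumes g: "\<And>a. a > 0 \<Longrightarrow> g a \<ge> 0" and p: "\<And>a. a > 0 \<Longrightarrow> p a \<ge> 0" and "K \<ge> 0"
    and energy: "\<And>a. a > 0 \<Longrightarrow> a * (g a)\<^sup>2 + (p a)\<^sup>2 \<le> X a + K * p a"
    and X_le: "\<And>a. a > 0 \<Longrightarrow> X a \<le> K * g a"
    and X_small: "\<And>\<epsilon>. \<epsilon> > 0 \<Longrightarrow> \<exists>C\<ge>0. \<forall>a>0. X a \<le> \<epsilon> * g a + C * p a"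
  shows "((\<lambda>a. a * g a) \<longlongrightarrow> 0) (at_right 0)"
proof -
  \<comment> \<open>Multiplying by \<open>a\<close> turns the energy inequality into one for
    \<open>a * g a\<close> and \<open>sqrt a * p a\<close>, the quantities that stay
    bounded.\<close>
  have scaled: "(a * g a)\<^sup>2 + (sqrt a * p a)\<^sup>2 \<le> a * X a + K * (a * p a)" if "a > 0" for a
  proof -
    have "(a * g a)\<^sup>2 + (sqrt a * p a)\<^sup>2 = a * (a * (g a)\<^sup>2 + (p a)\<^sup>2)"
      using that by (simp add: power_mult_distrib distrib_left power2_eq_square[of a])
    also have "\<dots> \<le> a * (X a + K * p a)"
      using energy[OF that] that by (intro mult_left_mono) auto
    finally show ?thesis by (simp add: algebra_simps)
  qed
  have bounds: "a * g a \<le> 2 * K" "a * p a \<le> 2 * K * sqrt a" if "a > 0" "a \<le> 1" for a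
  proof -
    define y q where "y = a * g a" and "q = sqrt a * p a"
    have "y \<ge> 0" "q \<ge> 0" using g[of a] p[of a] that by (simp_all add: y_def q_def)
    \<comment> \<open>Used twice: \<open>a * p a \<le> q\<close> as \<open>a \<le> 1\<close>, and
      later the rate \<open>sqrt a\<close> once \<open>q\<close> is bounded.\<close>
    have ap: "a * p a = sqrt a * q" using that by (simp add: q_def flip: mult.assoc)
    also have "\<dots> \<le> q" using that \<open>q \<ge> 0\<close> by (simp add: mult_left_le_one_le)
    finally have "a * p a \<le> q" .
    moreover have "a * X a \<le> K * y"
      using mult_left_mono[OF X_le, of a a] that by (simp add: y_def algebra_simps)
    ultimately have "y\<^sup>2 + q\<^sup>2 \<le> K * y + K * q"
      using scaled[OF \<open>a > 0\<close>] mult_left_mono[of "a * p a" q K] \<open>K \<ge> 0\<close> unfolding y_def q_def by linarith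
    \<comment> \<open>Completing squares places \<open>(y, q)\<close> in a disc through the origin
      centred at \<open>(K / 2, K / 2)\<close>; \<open>2 * K\<close> is a crude bound for its
      coordinates.\<close>
    then have sum: "(y - K / 2)\<^sup>2 + (q - K / 2)\<^sup>2 \<le> 2 * (K / 2)\<^sup>2"
      by (simp add: power2_eq_square algebra_simps)
    have *: "z \<le> 2 * K" if "(z - K / 2)\<^sup>2 \<le> 2 * (K / 2)\<^sup>2" for z
    proof -
      have "2 * (K / 2)\<^sup>2 \<le> (3 * K / 2)\<^sup>2" by (simp add: power2_eq_square)
      with that have "(z - K / 2)\<^sup>2 \<le> (3 * K / 2)\<^sup>2" by linarith
      then show ?thesis using power2_le_imp_le[of "z - K / 2" "3 * K / 2"] \<open>K \<ge> 0\<close> by simp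
    qed
    have "y \<le> 2 * K" "q \<le> 2 * K"
      using sum zero_le_power2[of "y - K / 2"] zero_le_power2[of "q - K / 2"] by (intro *; linarith)+
    then show "a * g a \<le> 2 * K" "a * p a \<le> 2 * K * sqrt a"
      using that mult_left_mono[of q "2 * K" "sqrt a"] ap by (simp_all add: y_def mult.commute)
  qed
  have small: "\<forall>\<^sub>F a in at_right 0. a > 0 \<and> a \<le> (1::real)"
    by (auto simp: eventually_at_right_field intro!: exI[of _ 1])
  have "((\<lambda>a. (a * g a)\<^sup>2) \<longlongrightarrow> 0) (at_right 0)"
  proof (rule order_tendstoI)
    fix e :: real assume "e < 0"
    then show "\<forall>\<^sub>F a in at_right 0. e < (a * g a)\<^sup>2"
      by (intro always_eventually allI) (auto intro: less_le_trans)
  next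
    fix e :: real assume "e > 0"
    \<comment> \<open>Chosen so that \<open>\<epsilon>\<close> times the bound \<open>2 * K\<close>
      stays below \<open>e / 2\<close>; the summand 4 keeps the denominator positive when
      \<open>K = 0\<close>.\<close>
    define \<epsilon> where "\<epsilon> = e / (4 * K + 4)"
    have "\<epsilon> > 0" using \<open>e > 0\<close> \<open>K \<ge> 0\<close> by (simp add: \<epsilon>_def)
    have \<epsilon>: "\<epsilon> * (2 * K) < e / 2" using \<open>e > 0\<close> \<open>K \<ge> 0\<close> by (simp add: \<epsilon>_def field_simps)
    obtain C where C: "C \<ge> 0" "\<And>a. a > 0 \<Longrightarrow> X a \<le> \<epsilon> * g a + C * p a"
      using X_small[OF \<open>\<epsilon> > 0\<close>] by blast
    \<comment> \<open>\<open>C\<close> may be large, but it is fixed before \<open>a\<close> tends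
      to 0, so the factor \<open>sqrt a\<close> wins.\<close>
    have "((\<lambda>a. (C + K) * (2 * K * sqrt a)) \<longlongrightarrow> (C + K) * (2 * K * sqrt 0)) (at_right 0)"
      by (intro tendsto_intros)
    then have "\<forall>\<^sub>F a in at_right 0. (C + K) * (2 * K * sqrt a) < e / 2"
      using \<open>e > 0\<close> by (intro order_tendstoD) auto
    with small show "\<forall>\<^sub>F a in at_right 0. (a * g a)\<^sup>2 < e"
    proof eventually_elim
      case (elim a)
      then have a: "a > 0" "a \<le> 1" by auto
      have "(a * g a)\<^sup>2 \<le> a * X a + K * (a * p a)"
        using scaled[OF a(1)] zero_le_power2[of "sqrt a * p a"] by linarith
      also have "a * X a \<le> \<epsilon> * (a * g a) + C * (a * p a)"
        using mult_left_mono[OF C(2)[OF a(1)], of a] a by (simp add: algebra_simps)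
      also have "\<epsilon> * (a * g a) \<le> \<epsilon> * (2 * K)"
        using bounds(1)[OF a] \<open>\<epsilon> > 0\<close> by simp
      finally have "(a * g a)\<^sup>2 \<le> \<epsilon> * (2 * K) + (C + K) * (a * p a)"
        by (simp add: algebra_simps)
      also have "(C + K) * (a * p a) \<le> (C + K) * (2 * K * sqrt a)"
        using bounds(2)[OF a] C(1) \<open>K \<ge> 0\<close> by (intro mult_left_mono) auto
      finally show ?case using elim \<epsilon> by linarith
    qed
  qed
  then have "((\<lambda>a. sqrt ((a * g a)\<^sup>2)) \<longlongrightarrow> sqrt 0) (at_right 0)"
    by (rule tendsto_real_sqrt)
  then show ?thesis by (simp add: tendsto_rabs_zero_iff)
qed

theorem theorem2:
  fixes A \<Omega> :: "(real^'n::finite) set"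
    and s :: "real \<Rightarrow> real^'n \<Rightarrow> real^'n"
  assumes "CARD('n) \<ge> 2"
    and "open A" and "bounded A" and "open \<Omega>" and "bounded \<Omega>"
    and "closure A \<subseteq> \<Omega>"
    and "lipschitz_boundary A"
    and "\<And>a. a > 0 \<Longrightarrow> s a \<in> H10_vec \<Omega>"
    and "\<And>a \<phi>. a > 0 \<Longrightarrow> \<phi> \<in> H10_vec \<Omega> \<Longrightarrow>
           a * (LINT x|lebesgue_on \<Omega>. HS_inner (weak_grad \<Omega> (s a) x) (weak_grad \<Omega> \<phi> x))
             + (LINT x|lebesgue_on \<Omega>. s a x \<bullet> \<phi> x)
           = boundary_flux \<Omega> A \<phi>"
  shows "(\<forall>\<phi>\<in>H10_vec \<Omega>.
            ((\<lambda>a. LINT x|lebesgue_on \<Omega>. s a x \<bullet> \<phi> x) \<longlongrightarrow> boundary_flux \<Omega> A \<phi>) (at_right 0))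
       \<and> (\<forall>a>0. (\<lambda>x. a *\<^sub>R s a x) \<in> H10_vec \<Omega>)
       \<and> ((\<lambda>a. H10_norm \<Omega> (\<lambda>x. a *\<^sub>R s a x)) \<longlongrightarrow> 0) (at_right 0)"
proof -
  interpret bounded_domain \<Omega> using \<open>open \<Omega>\<close> \<open>bounded \<Omega>\<close> by unfold_locales
  note s = assms(8) and weak_eq = assms(9)[unfolded HS_inner_eq_inner]
  let ?M = "lebesgue_on \<Omega>"
  define g where "g a = l2_norm ?M (weak_grad \<Omega> (s a))" for a
  define p where "p a = l2_norm ?M (s a)" for a
  define X where "X a = (LINT x|?M. weak_grad \<Omega> (s 1) x \<bullet> weak_grad \<Omega> (s a) x)" for a
  \<comment> \<open>One constant dominates both norms of the fixed solution \<open>s 1\<close>, as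
    the energy lemma requires.\<close>
  define K where "K = max (g 1) (p 1)"
  have K: "g 1 \<le> K" "p 1 \<le> K" "K \<ge> 0" by (simp_all add: K_def g_def p_def le_max_iff_disj)
  have lim: "((\<lambda>a. a * g a) \<longlongrightarrow> 0) (at_right 0)"
  proof (rule energy_tendsto_0)
    show "g a \<ge> 0" "p a \<ge> 0" for a by (simp_all add: g_def p_def)
    then have "p 1 * p a \<le> K * p a" "g 1 * g a \<le> K * g a" for a by (intro mult_right_mono K; simp)+
    show "a * (g a)\<^sup>2 + (p a)\<^sup>2 \<le> X a + K * p a" if "a > 0" for a
    proof -
      \<comment> \<open>The equations for \<open>a\<close> and for 1, both tested with
        \<open>s a\<close>, have the same flux on the right.\<close>
      have "a * (g a)\<^sup>2 + (p a)\<^sup>2 = X a + (LINT x|?M. s 1 x \<bullet> s a x)"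
        using weak_eq[OF that s[OF that]] weak_eq[of 1 "s a"] s[OF that]
        by (simp add: g_def p_def X_def l2_norm_square power2_norm_eq_inner)
      also have "(LINT x|?M. s 1 x \<bullet> s a x) \<le> p 1 * p a"
        unfolding p_def using that
        by (intro order_trans[OF abs_ge_self l2_Cauchy_Schwarz] H10_vec_sq_integrable s) auto
      finally show ?thesis using \<open>p 1 * p a \<le> K * p a\<close> by linarith
    qed
    show "X a \<le> K * g a" if "a > 0" for a
    proof -
      have "X a \<le> g 1 * g a"
        unfolding g_def X_def using that
        by (intro order_trans[OF abs_ge_self l2_Cauchy_Schwarz] weak_grad_sq_integrable s) auto
      then show ?thesis using \<open>g 1 * g a \<le> K * g a\<close> by linarith
    qed
    \<comment> \<open>The constant for \<open>s 1\<close> is uniform over all second arguments,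
      hence over all \<open>a\<close>.\<close>
    show "\<exists>C\<ge>0. \<forall>a>0. X a \<le> \<epsilon> * g a + C * p a" if "\<epsilon> > 0" for \<epsilon>
      using weak_grad_inner_bound[OF s[OF zero_less_one] that] s
      unfolding X_def g_def p_def by (meson abs_le_D1)
  qed (rule K)
  have pos: "\<forall>\<^sub>F a in at_right 0. (0::real) < a" by (rule eventually_at_right_less)
  have "((\<lambda>a. LINT x|?M. s a x \<bullet> \<phi> x) \<longlongrightarrow> boundary_flux \<Omega> A \<phi>) (at_right 0)"
    if \<phi>: "\<phi> \<in> H10_vec \<Omega>" for \<phi>
  proof -
    define I where "I a = (LINT x|?M. weak_grad \<Omega> (s a) x \<bullet> weak_grad \<Omega> \<phi> x)" for a
    \<comment> \<open>By the equation, \<open>a * I a\<close> is exactly the gap between the flux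
      and the integral of \<open>s a\<close> against \<open>\<phi>\<close>.\<close>
    have "((\<lambda>a. a * I a) \<longlongrightarrow> 0) (at_right 0)"
    proof (rule Lim_null_comparison)
      show "\<forall>\<^sub>F a in at_right 0. norm (a * I a) \<le> a * g a * l2_norm ?M (weak_grad \<Omega> \<phi>)"
        using pos
      proof eventually_elim
        case (elim a)
        then have "\<bar>I a\<bar> \<le> g a * l2_norm ?M (weak_grad \<Omega> \<phi>)"
          unfolding I_def g_def using \<phi> s by (intro l2_Cauchy_Schwarz weak_grad_sq_integrable) auto
        then show ?case using elim by (simp add: abs_mult mult.assoc)
      qed
      show "((\<lambda>a. a * g a * l2_norm ?M (weak_grad \<Omega> \<phi>)) \<longlongrightarrow> 0) (at_right 0)"
        using lim by (rule tendsto_mult_left_zero)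
    qed
    then have "((\<lambda>a. boundary_flux \<Omega> A \<phi> - a * I a) \<longlongrightarrow> boundary_flux \<Omega> A \<phi> - 0) (at_right 0)"
      by (intro tendsto_diff tendsto_const)
    moreover have "\<forall>\<^sub>F a in at_right 0. boundary_flux \<Omega> A \<phi> - a * I a = (LINT x|?M. s a x \<bullet> \<phi> x)"
      using pos
    proof eventually_elim
      case (elim a)
      then show ?case using weak_eq[OF elim \<phi>] unfolding I_def by linarith
    qed
    ultimately show ?thesis using Lim_transform_eventually by fastforce
  qed
  moreover have "((\<lambda>a. H10_norm \<Omega> (\<lambda>x. a *\<^sub>R s a x)) \<longlongrightarrow> 0) (at_right 0)"
    using lim
  proof (rule Lim_transform_eventually)
    show "\<forall>\<^sub>F a in at_right 0. a * g a = H10_norm \<Omega> (\<lambda>x. a *\<^sub>R s a x)"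
      using pos
    proof eventually_elim
      case (elim a)
      then show ?case using H10_norm_scaleR[OF s, of a a] by (simp add: g_def H10_norm_eq)
    qed
  qed
  ultimately show ?thesis using s H10_vec_scaleR by blast
qed

end
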